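(* Let $n\ge 2$ and $X=\{1,2,\dots,n\}$. Consider the following nondeterministic procedure. Step 1: set $\mathcal{S}_0=\{\emptyset\}$, $\mathcal{S}_1=\{\{1\},\dots,\{n\}\}$, $\mathcal{S}_n=\{X\}$, $\mathcal{S}^*=\mathcal{S}_0\cup\mathcal{S}_1\cup\mathcal{S}_n$, $k=0$. Step 2: if $n-k=2$, stop and output $\mathcal{S}^*$. Step 3: for each $S\in\mathcal{S}_{n-k}$ choose a two-element subset $\delta(S)=\{i_S,j_S\}\subseteq S$ such that $\delta(S)\not\subseteq T$ for every $T\in\mathcal{S}_{n-k}\setminus\{S\}$. Step 4: set $\mathcal{S}_{n-k-1}=\bigcup_{S\in\mathcal{S}_{n-k}}\{S\setminus\{i_S\},\,S\setminus\{j_S\}\}$. Step 5: $k:=k+1$. Step 6: $\mathcal{S}^*:=\mathcal{S}^*\cup\mathcal{S}_{n-k}$ and go to Step 2. Then every output $\mathcal{S}^*$ of this procedure, ordered by inclusion, is a finite super-atomic lattice in $\mathcal{L}(n)$. Moreover, every finite super-atomic lattice in $\mathcal{L}(n)$ is equal to some output $\mathcal{S}^*$ of the procedure (for suitable choices in Step 3).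
   Context: $\mathcal{L}(n)$ denotes the set of finite atomic lattices with $n$ atoms labeled $1,\dots,n$; each such lattice is represented as a family $\mathcal{S}$ of subsets of $\{1,\dots,n\}$, closed under intersection, containing $\emptyset$, $\{1,\dots,n\}$ and all singletons $\{i\}$, ordered by inclusion. A finite atomic lattice is a finite lattice with least element $0$ and greatest element in which every nonzero element is a join of atoms. For an element $p$ of a finite atomic lattice $P$ let $\mathrm{supp}(p)$ be the set of atoms below $p$ and $B_p=\{T\subseteq\mathrm{supp}(p): \bigvee_{b\in T}b=p\}$. $P$ is super-atomic if for every $p\in P$ that is neither $0$ nor an atom, and every $T\in B_p$, there exist exactly two elements $a,b\in T$ with $a\vee b=p$. *)

theory Defs
  imports "HOL-Algebra.Lattice"
begin

definition atoms :: "('a, 'b) gorder_scheme \<Rightarrow> 'a set" where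
  "atoms P = {a \<in> carrier P. a \<noteq> \<bottom>\<^bsub>P\<^esub> \<and>
     (\<forall>x\<in>carrier P. x \<sqsubseteq>\<^bsub>P\<^esub> a \<longrightarrow> x = \<bottom>\<^bsub>P\<^esub> \<or> x = a)}"

definition finite_atomic_lattice :: "('a, 'b) gorder_scheme \<Rightarrow> bool" where
  "finite_atomic_lattice P \<longleftrightarrow> Lattice.bounded_lattice P \<and> finite (carrier P) \<and>
     (\<forall>p\<in>carrier P. p \<noteq> \<bottom>\<^bsub>P\<^esub> \<longrightarrow> (\<exists>T\<subseteq>atoms P. p = \<Squnion>\<^bsub>P\<^esub>T))"

definition supp :: "('a, 'b) gorder_scheme \<Rightarrow> 'a \<Rightarrow> 'a set" where
  "supp P p = {a \<in> atoms P. a \<sqsubseteq>\<^bsub>P\<^esub> p}"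

definition join_sets :: "('a, 'b) gorder_scheme \<Rightarrow> 'a \<Rightarrow> 'a set set" where
  "join_sets P p = {T. T \<subseteq> supp P p \<and> \<Squnion>\<^bsub>P\<^esub>T = p}"

text \<open>
  ``Exactly two elements \<open>a, b\<close> of \<open>T\<close> with join \<open>p\<close>'' means that there is exactly one
  unordered pair of distinct elements of \<open>T\<close> whose join is \<open>p\<close>.
\<close>

definition super_atomic :: "('a, 'b) gorder_scheme \<Rightarrow> bool" where
  "super_atomic P \<longleftrightarrow> finite_atomic_lattice P \<and>
     (\<forall>p\<in>carrier P. p \<noteq> \<bottom>\<^bsub>P\<^esub> \<and> p \<notin> atoms P \<longrightarrow>
        (\<forall>T\<in>join_sets P p. \<exists>!D. \<exists>a\<in>T. \<exists>b\<in>T. a \<noteq> b \<and> D = {a, b} \<and> a \<squnion>\<^bsub>P\<^esub> b = p))"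

definition inclusion_order :: "'a set set \<Rightarrow> 'a set gorder" where
  "inclusion_order \<S> = \<lparr>carrier = \<S>, eq = (=), le = (\<subseteq>)\<rparr>"

definition labeled_atomic_lattices :: "nat \<Rightarrow> nat set set set" where
  "labeled_atomic_lattices n =
     {\<S>. \<S> \<subseteq> Pow {1..n} \<and> {} \<in> \<S> \<and> {1..n} \<in> \<S> \<and> (\<forall>i\<in>{1..n}. {i} \<in> \<S>) \<and>
          (\<forall>A\<in>\<S>. \<forall>B\<in>\<S>. A \<inter> B \<in> \<S>)}"

text \<open>
  \<open>procedure_state n k F \<S>\<close>: some run of the procedure on \<open>{1..n}\<close> reaches its stopping test with
  counter \<open>k\<close>, current level \<open>F\<close> (that is, \<open>S\<^sub>n\<^sub>-\<^sub>k\<close>) and accumulated family \<open>\<S>\<close>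
  (that is, \<open>S\<^sup>*\<close>). The functions \<open>i\<close> and \<open>j\<close> give the chosen pair \<open>\<delta>(S) = {i S, j S}\<close>.
\<close>

inductive procedure_state :: "nat \<Rightarrow> nat \<Rightarrow> nat set set \<Rightarrow> nat set set \<Rightarrow> bool" for n where
  start: "procedure_state n 0 {{1..n}} ({{}} \<union> (\<lambda>x. {x}) ` {1..n} \<union> {{1..n}})"
| step: "procedure_state n (k + 1) F' (\<S> \<union> F')"
    if "procedure_state n k F \<S>"
      and "n - k \<noteq> 2"
      and "\<forall>S\<in>F. i S \<in> S \<and> j S \<in> S \<and> i S \<noteq> j S \<and> (\<forall>T\<in>F - {S}. \<not> {i S, j S} \<subseteq> T)"
      and "F' = (\<Union>S\<in>F. {S - {i S}, S - {j S}})"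

definition procedure_output :: "nat \<Rightarrow> nat set set \<Rightarrow> bool" where
  "procedure_output n \<S> \<longleftrightarrow> (\<exists>k F. procedure_state n k F \<S> \<and> n - k = 2)"

end

theory Submission
  imports Defs "HOL.Hull"
begin

text \<open>
  A family is super-atomic iff every member \<open>S\<close> with at least two elements contains a pair \<open>D\<close> such
  that a subset of \<open>S\<close> generates \<open>S\<close> exactly if it contains \<open>D\<close>. Equivalently, removing an element
  of \<open>D\<close> from \<open>S\<close> yields a member again, and \<open>D\<close> lies in no other member of the same or smaller
  size. The existence of pairs of the latter kind already forces closure under intersection: for
  \<open>A \<subseteq> S\<close> with at least two elements, a minimal member \<open>V\<close> with \<open>A \<subseteq> V \<subseteq> S\<close> has its pair inside \<open>A\<close>
  and hence does not depend on \<open>S\<close>, so \<open>A = S \<inter> T\<close> is a member. On the other hand, such pairs are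
  exactly what the procedure produces: if the pair chosen for \<open>S\<close> were contained in a smaller set,
  it would be contained in the ancestor of that set on the level of \<open>S\<close>, which has to be \<open>S\<close> itself.
\<close>

abbreviation singletons :: "'a set \<Rightarrow> 'a set set" where
  "singletons A \<equiv> (\<lambda>x. {x}) ` A"

lemma card_less_2_iff_singletons:
  assumes "finite X" "S \<subseteq> X"
  shows "card S < 2 \<longleftrightarrow> S \<in> insert {} (singletons X)"
proof -
  have "finite S" using assms finite_subset by blast
  then have "card S < 2 \<longleftrightarrow> S = {} \<or> (\<exists>x. S = {x})"
    by (auto simp: less_2_cases_iff card_1_singleton_iff)
  with assms(2) show ?thesis by auto
qed

lemma ex1_image_iff: "inj f \<Longrightarrow> (\<exists>!y. \<exists>x. y = f x \<and> P x) \<longleftrightarrow> (\<exists>!x. P x)"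
  by (blast dest: injD)

section \<open>Closure and generating pairs\<close>

abbreviation closure_in :: "'a set set \<Rightarrow> 'a set \<Rightarrow> 'a set" where
  "closure_in \<S> A \<equiv> (\<lambda>S. S \<in> \<S>) hull A"

definition generating_pair :: "'a set set \<Rightarrow> 'a set \<Rightarrow> 'a set \<Rightarrow> bool" where
  "generating_pair \<S> S D \<longleftrightarrow> card D = 2 \<and> (\<forall>A\<subseteq>S. closure_in \<S> A = S \<longleftrightarrow> D \<subseteq> A)"

lemma ex_generating_pair_iff:
  assumes "S \<in> \<S>"
  shows "(\<exists>D. generating_pair \<S> S D) \<longleftrightarrow>
    (\<forall>A\<subseteq>S. closure_in \<S> A = S \<longrightarrow> (\<exists>!D. D \<subseteq> A \<and> card D = 2 \<and> closure_in \<S> D = S))"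
    (is "_ \<longleftrightarrow> (\<forall>A\<subseteq>S. _ \<longrightarrow> (\<exists>!D. ?Q A D))")
proof
  assume "\<exists>D. generating_pair \<S> S D"
  then obtain D where card: "card D = 2" and generates: "\<And>A. A \<subseteq> S \<Longrightarrow> closure_in \<S> A = S \<longleftrightarrow> D \<subseteq> A"
    unfolding generating_pair_def by blast
  show "\<forall>A\<subseteq>S. closure_in \<S> A = S \<longrightarrow> (\<exists>!D. ?Q A D)"
  proof (intro allI impI ex1I)
    fix A assume A: "A \<subseteq> S" "closure_in \<S> A = S"
    then have "D \<subseteq> A" using generates by blast
    with A card generates show "?Q A D" by blast
    fix E assume E: "?Q A E"
    then have "D \<subseteq> E" using A generates by blast
    moreover have "finite E" using E by (intro card_ge_0_finite) simp
    ultimately show "E = D" using E card by (metis card_subset_eq)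
  qed
next
  assume unique: "\<forall>A\<subseteq>S. closure_in \<S> A = S \<longrightarrow> (\<exists>!D. ?Q A D)"
  have "\<exists>!D. ?Q S D" using unique hull_same[of "\<lambda>S. S \<in> \<S>" S] assms by simp
  then obtain D where D: "?Q S D" and only: "\<forall>E. ?Q S E \<longrightarrow> E = D" by (rule ex1E)
  have "closure_in \<S> A = S \<longleftrightarrow> D \<subseteq> A" if A: "A \<subseteq> S" for A
  proof
    assume "closure_in \<S> A = S"
    then have "\<exists>E. ?Q A E" using unique A by (intro ex1_implies_ex) simp
    then obtain E where E: "?Q A E" ..
    then have "E \<subseteq> S" using A by (blast intro: order_trans)
    with E only have "E = D" by simp
    with E show "D \<subseteq> A" by simp
  next
    assume "D \<subseteq> A"
    then have "closure_in \<S> D \<subseteq> closure_in \<S> A" by (rule hull_mono)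
    moreover have "closure_in \<S> A \<subseteq> S" using A assms by (rule hull_minimal)
    ultimately show "closure_in \<S> A = S" using D by blast
  qed
  with D show "\<exists>D. generating_pair \<S> S D" unfolding generating_pair_def by blast
qed

section \<open>Removable pairs\<close>

definition separating_pair :: "'a set set \<Rightarrow> 'a set \<Rightarrow> 'a set \<Rightarrow> bool" where
  "separating_pair \<F> S D \<longleftrightarrow> D \<subseteq> S \<and> card D = 2 \<and> (\<forall>T\<in>\<F>. D \<subseteq> T \<longrightarrow> T = S)"

definition removable_pair :: "'a set set \<Rightarrow> 'a set \<Rightarrow> 'a set \<Rightarrow> bool" where
  "removable_pair \<S> S D \<longleftrightarrow>
     separating_pair {T \<in> \<S>. card T \<le> card S} S D \<and> (\<forall>x\<in>D. S - {x} \<in> \<S>)"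

lemma removable_pairD:
  assumes "removable_pair \<S> S D"
  shows "D \<subseteq> S" "card D = 2" "\<And>x. x \<in> D \<Longrightarrow> S - {x} \<in> \<S>"
    "\<And>T. T \<in> \<S> \<Longrightarrow> D \<subseteq> T \<Longrightarrow> card T \<le> card S \<Longrightarrow> T = S"
  using assms unfolding removable_pair_def separating_pair_def by auto

lemma removable_pair_unique_superset:
  assumes "removable_pair \<S> V D" "removable_pair \<S> W E" "V \<in> \<S>" "W \<in> \<S>"
    and "D \<subseteq> A" "A \<subseteq> V" "E \<subseteq> A" "A \<subseteq> W"
  shows "V = W"
proof (cases "card W \<le> card V")
  case True
  have "D \<subseteq> W" using assms(5,8) by (rule order_trans)
  with True show ?thesis using removable_pairD(4)[OF assms(1,4)] by simp
next
  case False
  have "E \<subseteq> V" using assms(7,6) by (rule order_trans)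
  with False show ?thesis using removable_pairD(4)[OF assms(2,3)] by simp
qed

locale pointed_family =
  fixes X :: "'a set" and \<S> :: "'a set set"
  assumes finite_X: "finite X" and subsets: "\<S> \<subseteq> Pow X"
    and empty: "{} \<in> \<S>" and top: "X \<in> \<S>" and singleton: "x \<in> X \<Longrightarrow> {x} \<in> \<S>"
begin

lemma finite_family: "finite \<S>"
  using subsets finite_X by (meson finite_Pow_iff finite_subset)

lemma finite_member: "S \<in> \<S> \<Longrightarrow> finite S"
  using subsets finite_X finite_subset by blast

lemma small_member: "S \<subseteq> X \<Longrightarrow> card S < 2 \<Longrightarrow> S \<in> \<S>"
  using card_less_2_iff_singletons[OF finite_X] empty singleton by blast

lemma removable_pair_self:
  assumes "S \<in> \<S>" "card S = 2"
  shows "removable_pair \<S> S S"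
proof -
  have "S - {x} \<in> \<S>" if "x \<in> S" for x
    using assms that subsets by (intro small_member) auto
  moreover have "T = S" if "T \<in> \<S>" "S \<subseteq> T" "card T \<le> card S" for T
    using that finite_member card_seteq by metis
  ultimately show ?thesis
    using assms unfolding removable_pair_def separating_pair_def by blast
qed

end

locale atomic_family = pointed_family +
  assumes Int: "A \<in> \<S> \<Longrightarrow> B \<in> \<S> \<Longrightarrow> A \<inter> B \<in> \<S>"
begin

lemma closure_in_member:
  assumes "A \<subseteq> X"
  shows "closure_in \<S> A \<in> \<S>"
proof -
  have "\<Inter>\<F> \<in> \<S>" if "finite \<F>" "\<F> \<noteq> {}" "\<F> \<subseteq> \<S>" for \<F>
    using that by (induction rule: finite_ne_induct) (auto intro: Int)
  moreover have "{S \<in> \<S>. A \<subseteq> S} \<noteq> {}" using top assms by blast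
  ultimately show ?thesis unfolding hull_def using finite_family by simp
qed

lemma generating_pair_if_removable_pair:
  assumes S: "S \<in> \<S>" and D: "removable_pair \<S> S D"
  shows "generating_pair \<S> S D"
proof -
  have "closure_in \<S> A = S \<longleftrightarrow> D \<subseteq> A" if A: "A \<subseteq> S" for A
  proof
    assume generates: "closure_in \<S> A = S"
    have "x \<in> A" if x: "x \<in> D" for x
    proof (rule ccontr)
      assume "x \<notin> A"
      then have "closure_in \<S> A \<subseteq> S - {x}"
        using A removable_pairD(3)[OF D x] by (intro hull_minimal) auto
      with generates x removable_pairD(1)[OF D] show False by blast
    qed
    then show "D \<subseteq> A" by blast
  next
    assume "D \<subseteq> A"
    have le: "closure_in \<S> A \<subseteq> S" using A S by (rule hull_minimal)
    show "closure_in \<S> A = S"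
    proof (rule removable_pairD(4)[OF D])
      show "closure_in \<S> A \<in> \<S>" using A S subsets by (intro closure_in_member) blast
      show "D \<subseteq> closure_in \<S> A" using \<open>D \<subseteq> A\<close> by (rule order_trans) (rule hull_subset)
      show "card (closure_in \<S> A) \<le> card S" using le finite_member[OF S] by (rule card_mono[rotated])
    qed
  qed
  then show ?thesis
    unfolding generating_pair_def using removable_pairD(2)[OF D] by blast
qed

lemma removable_pair_if_generating_pair:
  assumes S: "S \<in> \<S>" and "generating_pair \<S> S D"
  shows "removable_pair \<S> S D"
proof -
  have card: "card D = 2" and generates: "\<And>A. A \<subseteq> S \<Longrightarrow> closure_in \<S> A = S \<longleftrightarrow> D \<subseteq> A"
    using assms(2) unfolding generating_pair_def by auto
  have "closure_in \<S> S = S" using S by (rule hull_same)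
  then have sub: "D \<subseteq> S" using generates by blast
  have "S - {x} \<in> \<S>" if x: "x \<in> D" for x
  proof -
    have "closure_in \<S> (S - {x}) \<subseteq> S" using S by (intro hull_minimal) auto
    moreover have "closure_in \<S> (S - {x}) \<noteq> S" using generates[of "S - {x}"] x by blast
    ultimately have "closure_in \<S> (S - {x}) = S - {x}"
      using hull_subset[of "S - {x}" "\<lambda>S. S \<in> \<S>"] by blast
    moreover have "S - {x} \<subseteq> X" using S subsets by blast
    ultimately show ?thesis using closure_in_member by metis
  qed
  moreover have "T = S" if "T \<in> \<S>" "D \<subseteq> T" "card T \<le> card S" for T
  proof -
    have "closure_in \<S> D \<subseteq> T" using that(2,1) by (rule hull_minimal)
    then have "S \<subseteq> T" using generates[OF sub] by simp
    then show ?thesis using that finite_member card_seteq by metis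
  qed
  ultimately show ?thesis
    using sub card unfolding removable_pair_def separating_pair_def by blast
qed

end

section \<open>Families with removable pairs\<close>

text \<open>
  The families occurring in an unfinished run of the procedure: the sets of the current level,
  those of cardinality \<open>m\<close>, have not been assigned a pair yet.
\<close>

locale pair_generated_above = pointed_family +
  fixes m :: nat
  assumes two_le: "2 \<le> m"
    and card_ge: "S \<in> \<S> \<Longrightarrow> 2 \<le> card S \<Longrightarrow> m \<le> card S"
    and ex_removable_pair_above: "S \<in> \<S> \<Longrightarrow> m < card S \<Longrightarrow> \<exists>D. removable_pair \<S> S D"

lemma pair_generated_above_card_iff:
  assumes "finite X" "2 \<le> card X"
  shows "pair_generated_above X \<S> (card X) \<longleftrightarrow> \<S> = {{}} \<union> singletons X \<union> {X}"
proof
  assume "pair_generated_above X \<S> (card X)"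
  then interpret pair_generated_above X \<S> "card X" .
  have "S \<in> {{}} \<union> singletons X \<union> {X}" if S: "S \<in> \<S>" for S
  proof (cases "2 \<le> card S")
    case True
    then have "S = X"
      using card_ge[OF S] S subsets by (intro card_seteq[OF finite_X]) auto
    then show ?thesis by blast
  next
    case False
    then show ?thesis
      using card_less_2_iff_singletons[OF finite_X, of S] S subsets by auto
  qed
  then show "\<S> = {{}} \<union> singletons X \<union> {X}" using empty singleton top by blast
next
  assume "\<S> = {{}} \<union> singletons X \<union> {X}"
  with assms show "pair_generated_above X \<S> (card X)" by unfold_locales auto
qed

locale pair_generated_family = pair_generated_above X \<S> 2 for X :: "'a set" and \<S>
begin

lemma ex_removable_pair:
  assumes "S \<in> \<S>" "2 \<le> card S"
  shows "\<exists>D. removable_pair \<S> S D"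
  using assms ex_removable_pair_above removable_pair_self by (cases "card S = 2") auto

lemma ex_between_with_removable_pair:
  assumes S: "S \<in> \<S>" "A \<subseteq> S" and A: "2 \<le> card A"
  obtains V D where "V \<in> \<S>" "A \<subseteq> V" "V \<subseteq> S" "removable_pair \<S> V D" "D \<subseteq> A"
proof -
  let ?\<U> = "{V \<in> \<S>. A \<subseteq> V}"
  have "finite ?\<U>" "S \<in> ?\<U>" using finite_family S by auto
  then obtain V where V: "V \<in> ?\<U>" "V \<subseteq> S" and minimal: "\<And>W. W \<in> ?\<U> \<Longrightarrow> W \<subseteq> V \<Longrightarrow> V = W"
    using finite_has_minimal2 by meson
  have "card A \<le> card V" using V finite_member by (intro card_mono) auto
  then obtain D where D: "removable_pair \<S> V D" using ex_removable_pair[of V] V A by auto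
  have "D \<subseteq> A"
  proof
    fix x assume x: "x \<in> D"
    then have "V - {x} \<in> \<S>" "x \<in> V" using removable_pairD(1,3)[OF D] by blast+
    then show "x \<in> A" using minimal[of "V - {x}"] V by blast
  qed
  with V D that show thesis by blast
qed

sublocale atomic_family
proof
  fix S T assume S: "S \<in> \<S>" and T: "T \<in> \<S>"
  show "S \<inter> T \<in> \<S>"
  proof (cases "2 \<le> card (S \<inter> T)")
    case True
    obtain V D where V: "V \<in> \<S>" "S \<inter> T \<subseteq> V" "V \<subseteq> S" "removable_pair \<S> V D" "D \<subseteq> S \<inter> T"
      using ex_between_with_removable_pair[OF S Int_lower1 True] by blast
    obtain W E where W: "W \<in> \<S>" "S \<inter> T \<subseteq> W" "W \<subseteq> T" "removable_pair \<S> W E" "E \<subseteq> S \<inter> T"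
      using ex_between_with_removable_pair[OF T Int_lower2 True] by blast
    have "V = W" using V W by (intro removable_pair_unique_superset[of \<S> V D W E "S \<inter> T"])
    then have "V = S \<inter> T" using V W by blast
    with V show ?thesis by simp
  next
    case False
    moreover have "S \<inter> T \<subseteq> X" using S subsets by blast
    ultimately show ?thesis by (intro small_member) auto
  qed
qed

end

lemma pair_generated_family_iff:
  "pair_generated_family X \<S> \<longleftrightarrow>
    atomic_family X \<S> \<and> (\<forall>S\<in>\<S>. 2 \<le> card S \<longrightarrow> (\<exists>D. generating_pair \<S> S D))"
proof
  assume "pair_generated_family X \<S>"
  then interpret pair_generated_family X \<S> .
  show "atomic_family X \<S> \<and> (\<forall>S\<in>\<S>. 2 \<le> card S \<longrightarrow> (\<exists>D. generating_pair \<S> S D))"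
    using atomic_family_axioms ex_removable_pair generating_pair_if_removable_pair by blast
next
  assume pairs: "atomic_family X \<S> \<and> (\<forall>S\<in>\<S>. 2 \<le> card S \<longrightarrow> (\<exists>D. generating_pair \<S> S D))"
  then interpret atomic_family X \<S> by blast
  show "pair_generated_family X \<S>"
  proof
    show "\<exists>D. removable_pair \<S> S D" if S: "S \<in> \<S>" "2 < card S" for S
    proof -
      obtain D where "generating_pair \<S> S D" using pairs S less_imp_le by blast
      then show ?thesis using removable_pair_if_generating_pair[OF S(1)] by blast
    qed
  qed auto
qed

section \<open>The lattice of a family of sets\<close>

lemma inclusion_order_simps:
  "carrier (inclusion_order \<S>) = \<S>"
  "x \<sqsubseteq>\<^bsub>inclusion_order \<S>\<^esub> y \<longleftrightarrow> x \<subseteq> y"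
  "x .=\<^bsub>inclusion_order \<S>\<^esub> y \<longleftrightarrow> x = y"
  by (simp_all add: inclusion_order_def)

context pointed_family
begin

abbreviation L :: "'a set gorder" where "L \<equiv> inclusion_order \<S>"

lemma least_L_iff: "least L x \<S> \<longleftrightarrow> x = {}"
  using empty unfolding least_def inclusion_order_simps by blast

lemma greatest_L: "greatest L X \<S>"
  using top subsets unfolding greatest_def inclusion_order_simps by blast

lemma bottom_L: "\<bottom>\<^bsub>L\<^esub> = {}"
  unfolding bottom_def inclusion_order_simps least_L_iff by simp

lemma atoms_L: "atoms L = singletons X"
proof
  show "atoms L \<subseteq> singletons X"
  proof
    fix a assume "a \<in> atoms L"
    then have a: "a \<in> \<S>" "a \<noteq> {}" and minimal: "\<And>x. x \<in> \<S> \<Longrightarrow> x \<subseteq> a \<Longrightarrow> x = {} \<or> x = a"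
      unfolding atoms_def bottom_L inclusion_order_simps by auto
    then obtain x where "x \<in> a" by blast
    moreover from this have "x \<in> X" using a subsets by blast
    ultimately show "a \<in> singletons X" using minimal[OF singleton] by blast
  qed
  show "singletons X \<subseteq> atoms L"
    unfolding atoms_def bottom_L inclusion_order_simps using singleton by auto
qed

lemma neither_bottom_nor_atom_iff:
  assumes "p \<in> \<S>"
  shows "p \<noteq> \<bottom>\<^bsub>L\<^esub> \<and> p \<notin> atoms L \<longleftrightarrow> 2 \<le> card p"
  using card_less_2_iff_singletons[OF finite_X, of p] assms subsets
  unfolding bottom_L atoms_L by (auto simp flip: not_less)

lemma supp_L:
  assumes "p \<in> \<S>"
  shows "supp L p = singletons p"
  using assms subsets unfolding supp_def atoms_L inclusion_order_simps by blast

end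

context atomic_family
begin

lemma least_Upper_L_iff:
  assumes "T \<subseteq> \<S>"
  shows "least L M (Upper L T) \<longleftrightarrow> M = closure_in \<S> (\<Union>T)"
proof -
  have Upper: "Upper L T = {S \<in> \<S>. \<Union>T \<subseteq> S}"
    using assms unfolding Upper_def inclusion_order_simps by blast
  have "\<Union>T \<subseteq> X" using assms subsets by blast
  then have member: "closure_in \<S> (\<Union>T) \<in> Upper L T"
    unfolding Upper by (auto intro: closure_in_member hull_inc)
  have lower: "closure_in \<S> (\<Union>T) \<subseteq> S" if "S \<in> Upper L T" for S
    using that unfolding Upper by (intro hull_minimal) auto
  have "Upper L T \<subseteq> \<S>" unfolding Upper by simp
  then show ?thesis
    unfolding least_def inclusion_order_simps using member lower by (metis subset_antisym)
qed

lemma sup_L: "T \<subseteq> \<S> \<Longrightarrow> \<Squnion>\<^bsub>L\<^esub>T = closure_in \<S> (\<Union>T)"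
  unfolding Lattice.sup_def by (simp add: least_Upper_L_iff)

lemma sup_singletons_L:
  assumes "A \<subseteq> X"
  shows "\<Squnion>\<^bsub>L\<^esub>(singletons A) = closure_in \<S> A"
proof -
  have "singletons A \<subseteq> \<S>" using assms singleton by blast
  then show ?thesis by (simp add: sup_L)
qed

lemma join_singletons_L:
  assumes "x \<in> X" "y \<in> X"
  shows "{x} \<squnion>\<^bsub>L\<^esub> {y} = closure_in \<S> {x, y}"
  using sup_singletons_L[of "{x, y}"] assms unfolding join_def by simp

lemma greatest_Lower_L:
  assumes "a \<in> \<S>" "b \<in> \<S>"
  shows "greatest L (a \<inter> b) (Lower L {a, b})"
  using assms Int unfolding greatest_def Lower_def inclusion_order_simps by auto

lemma bounded_lattice_L: "Lattice.bounded_lattice L"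
proof unfold_locales
  show "\<exists>x. greatest L x (carrier L)" "\<exists>x. least L x (carrier L)"
    unfolding inclusion_order_simps using greatest_L least_L_iff by blast+
next
  fix x y assume "x \<in> carrier L" "y \<in> carrier L"
  then have xy: "x \<in> \<S>" "y \<in> \<S>" unfolding inclusion_order_simps .
  then show "\<exists>s. least L s (Upper L {x, y})" using least_Upper_L_iff[of "{x, y}"] by blast
  show "\<exists>s. greatest L s (Lower L {x, y})" using greatest_Lower_L[OF xy] by blast
qed (auto simp: inclusion_order_simps fun_eq_iff)

lemma finite_atomic_lattice_L: "finite_atomic_lattice L"
proof -
  have "\<exists>T\<subseteq>atoms L. p = \<Squnion>\<^bsub>L\<^esub>T" if p: "p \<in> \<S>" for p
  proof (intro exI conjI)
    have sub: "p \<subseteq> X" using p subsets by blast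
    then show "singletons p \<subseteq> atoms L" unfolding atoms_L by blast
    show "p = \<Squnion>\<^bsub>L\<^esub>(singletons p)"
      unfolding sup_singletons_L[OF sub] using p by (rule hull_same[symmetric])
  qed
  then show ?thesis
    unfolding finite_atomic_lattice_def inclusion_order_simps
    using bounded_lattice_L finite_family by blast
qed

lemma join_sets_L:
  assumes "p \<in> \<S>"
  shows "join_sets L p = singletons ` {A. A \<subseteq> p \<and> closure_in \<S> A = p}"
proof -
  have "\<Squnion>\<^bsub>L\<^esub>(singletons A) = closure_in \<S> A" if "A \<subseteq> p" for A
    using that assms subsets by (intro sup_singletons_L) blast
  then show ?thesis
    unfolding join_sets_def supp_L[OF assms] by (auto simp: subset_image_iff)
qed

lemma ex1_joining_pair_L_iff:
  assumes A: "A \<subseteq> X"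
  shows "(\<exists>!D. \<exists>a\<in>singletons A. \<exists>b\<in>singletons A. a \<noteq> b \<and> D = {a, b} \<and> a \<squnion>\<^bsub>L\<^esub> b = p) \<longleftrightarrow>
    (\<exists>!D. D \<subseteq> A \<and> card D = 2 \<and> closure_in \<S> D = p)"
    (is "(\<exists>!D. ?Q D) \<longleftrightarrow> (\<exists>!D. ?R D)")
proof -
  have "?Q D \<longleftrightarrow> (\<exists>x\<in>A. \<exists>y\<in>A. x \<noteq> y \<and> D = singletons {x, y} \<and> closure_in \<S> {x, y} = p)" for D
    using A join_singletons_L by (auto simp: subset_iff)
  moreover have "?R E \<longleftrightarrow> (\<exists>x\<in>A. \<exists>y\<in>A. x \<noteq> y \<and> E = {x, y} \<and> closure_in \<S> {x, y} = p)" for E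
    unfolding card_2_iff by auto
  ultimately have "?Q D \<longleftrightarrow> (\<exists>E. D = singletons E \<and> ?R E)" for D
    by (simp only:) blast
  moreover have "inj (\<lambda>E :: 'a set. singletons E)" by (simp add: inj_def inj_image_eq_iff)
  ultimately show ?thesis by (simp only: ex1_image_iff)
qed

lemma super_atomic_L_iff:
  "super_atomic L \<longleftrightarrow> (\<forall>S\<in>\<S>. 2 \<le> card S \<longrightarrow> (\<exists>D. generating_pair \<S> S D))"
proof -
  have "(\<forall>T\<in>join_sets L S. \<exists>!D. \<exists>a\<in>T. \<exists>b\<in>T. a \<noteq> b \<and> D = {a, b} \<and> a \<squnion>\<^bsub>L\<^esub> b = S) \<longleftrightarrow>
      (\<exists>D. generating_pair \<S> S D)" if S: "S \<in> \<S>" for S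
  proof -
    have "A \<subseteq> X" if "A \<subseteq> S" for A using that S subsets by blast
    then show ?thesis
      unfolding join_sets_L[OF S] ex_generating_pair_iff[OF S]
      by (simp add: ex1_joining_pair_L_iff imp_conjL del: bex_simps cong: imp_cong)
  qed
  then show ?thesis
    unfolding super_atomic_def inclusion_order_simps
    using finite_atomic_lattice_L neither_bottom_nor_atom_iff by simp
qed

end

section \<open>Runs of the procedure\<close>

definition level :: "'a set set \<Rightarrow> nat \<Rightarrow> 'a set set" where
  "level \<S> m = {S \<in> \<S>. card S = m}"

definition children :: "('a set \<Rightarrow> 'a set) \<Rightarrow> 'a set set \<Rightarrow> 'a set set" where
  "children \<delta> \<F> = (\<Union>S\<in>\<F>. (\<lambda>x. S - {x}) ` \<delta> S)"

definition next_level :: "'a set set \<Rightarrow> 'a set set \<Rightarrow> bool" where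
  "next_level \<F> \<F>' \<longleftrightarrow> (\<exists>\<delta>. (\<forall>S\<in>\<F>. separating_pair \<F> S (\<delta> S)) \<and> \<F>' = children \<delta> \<F>)"

lemma separating_pair_Un_children:
  assumes D: "separating_pair {T \<in> \<S>. card T \<le> card S} S D" and S: "m \<le> card S"
    and chosen: "S \<in> level \<S> m \<Longrightarrow> D = \<delta> S"
  shows "separating_pair {T \<in> \<S> \<union> children \<delta> (level \<S> m). card T \<le> card S} S D"
proof -
  have "\<not> D \<subseteq> T" if T: "T \<in> children \<delta> (level \<S> m)" for T
  proof
    assume "D \<subseteq> T"
    obtain P x where P: "P \<in> level \<S> m" "x \<in> \<delta> P" "T = P - {x}"
      using T unfolding children_def by blast
    have "P = S" using D P(1,3) S \<open>D \<subseteq> T\<close> unfolding separating_pair_def level_def by auto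
    then show False using chosen P \<open>D \<subseteq> T\<close> by blast
  qed
  with D show ?thesis unfolding separating_pair_def by blast
qed

context pair_generated_above
begin

lemma separating_pair_if_level:
  assumes S: "S \<in> level \<S> m" and D: "separating_pair (level \<S> m) S D"
  shows "separating_pair {T \<in> \<S>. card T \<le> card S} S D"
proof -
  have "T \<in> level \<S> m" if T: "T \<in> \<S>" "card T \<le> card S" "D \<subseteq> T" for T
  proof -
    have "2 \<le> card T" using T D finite_member card_mono unfolding separating_pair_def by metis
    then show ?thesis using card_ge[of T] T S unfolding level_def by simp
  qed
  with D show ?thesis unfolding separating_pair_def by blast
qed

lemma ex_removable_pair_Un_children:
  assumes S: "S \<in> \<S>" "m \<le> card S"
    and \<delta>: "\<forall>S\<in>level \<S> m. separating_pair (level \<S> m) S (\<delta> S)"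
  shows "\<exists>D. removable_pair (\<S> \<union> children \<delta> (level \<S> m)) S D"
proof (cases "S \<in> level \<S> m")
  case True
  then have "separating_pair {T \<in> \<S>. card T \<le> card S} S (\<delta> S)"
    using \<delta> separating_pair_if_level by blast
  then have "separating_pair {T \<in> \<S> \<union> children \<delta> (level \<S> m). card T \<le> card S} S (\<delta> S)"
    using S(2) by (rule separating_pair_Un_children) simp
  then show ?thesis using True unfolding removable_pair_def children_def by blast
next
  case False
  then have "m < card S" using S unfolding level_def by simp
  then obtain D where D: "removable_pair \<S> S D" using ex_removable_pair_above[OF S(1)] by blast
  then have "separating_pair {T \<in> \<S> \<union> children \<delta> (level \<S> m). card T \<le> card S} S D"
    using False S(2) unfolding removable_pair_def by (intro separating_pair_Un_children) auto
  then show ?thesis using D unfolding removable_pair_def by blast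
qed

lemma ex_parent:
  assumes "S \<in> level \<S> m" "m < card X"
  obtains P where "P \<in> level \<S> (Suc m)" "\<And>D. removable_pair \<S> P D \<Longrightarrow> \<exists>x\<in>D. S = P - {x}"
proof -
  have S: "S \<in> \<S>" "card S = m" using assms(1) unfolding level_def by auto
  let ?\<U> = "{V \<in> \<S>. S \<subset> V}"
  have "S \<subset> X" using S assms(2) subsets by blast
  then have "finite ?\<U>" "X \<in> ?\<U>" using finite_family top by auto
  then obtain P where "P \<in> ?\<U>" and minimal: "\<And>W. W \<in> ?\<U> \<Longrightarrow> W \<subseteq> P \<Longrightarrow> P = W"
    using finite_has_minimal2 by meson
  then have P: "P \<in> \<S>" "S \<subset> P" by auto
  have less: "card S < card P" using P finite_member by (intro psubset_card_mono)
  have removed: "\<exists>x\<in>D. S = P - {x}" if D: "removable_pair \<S> P D" for D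
  proof -
    have "\<not> D \<subseteq> S" using removable_pairD(4)[OF D S(1)] less by auto
    then obtain x where x: "x \<in> D" "x \<notin> S" by blast
    then have "P - {x} \<in> \<S>" "x \<in> P" using removable_pairD(1,3)[OF D] by blast+
    then have "S = P - {x}" using minimal[of "P - {x}"] P(2) x(2) by blast
    with x(1) show ?thesis by blast
  qed
  obtain D where D: "removable_pair \<S> P D" using ex_removable_pair_above P(1) less S(2) by blast
  then obtain x where "x \<in> P" "S = P - {x}" using removed[OF D] removable_pairD(1)[OF D] by blast
  then have "card P = Suc m" using S(2) finite_member[OF P(1)] by (metis card_Suc_Diff1)
  with P(1) have "P \<in> level \<S> (Suc m)" unfolding level_def by simp
  then show thesis using removed that by blast
qed

lemma pair_generated_above_Diff_level:
  assumes "m < card X"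
  shows "pair_generated_above X (\<S> - level \<S> m) (Suc m)"
proof
  show "\<S> - level \<S> m \<subseteq> Pow X" "{} \<in> \<S> - level \<S> m" "X \<in> \<S> - level \<S> m"
    "\<And>x. x \<in> X \<Longrightarrow> {x} \<in> \<S> - level \<S> m" "finite X" "2 \<le> Suc m"
    using subsets empty top singleton finite_X two_le assms unfolding level_def by auto
  fix S assume S: "S \<in> \<S> - level \<S> m"
  show "Suc m \<le> card S" if "2 \<le> card S"
    using card_ge[OF _ that] S unfolding level_def by fastforce
  show "\<exists>D. removable_pair (\<S> - level \<S> m) S D" if less: "Suc m < card S"
  proof -
    obtain D where D: "removable_pair \<S> S D" using ex_removable_pair_above[of S] S less by auto
    have "S - {x} \<notin> level \<S> m" if "x \<in> D" for x
      using less removable_pairD(1)[OF D] that unfolding level_def by auto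
    with D show ?thesis
      unfolding removable_pair_def separating_pair_def by (intro exI[of _ D]) simp
  qed
qed

lemma level_eq_children:
  assumes "m < card X"
    and \<delta>: "\<forall>S\<in>level \<S> (Suc m). removable_pair \<S> S (\<delta> S)"
  shows "level \<S> m = children \<delta> (level \<S> (Suc m))"
proof
  show "level \<S> m \<subseteq> children \<delta> (level \<S> (Suc m))"
  proof
    fix S assume "S \<in> level \<S> m"
    then obtain P where "P \<in> level \<S> (Suc m)"
        "\<And>D. removable_pair \<S> P D \<Longrightarrow> \<exists>x\<in>D. S = P - {x}"
      using ex_parent assms(1) by blast
    then show "S \<in> children \<delta> (level \<S> (Suc m))" using \<delta> unfolding children_def by blast
  qed
  show "children \<delta> (level \<S> (Suc m)) \<subseteq> level \<S> m"
  proof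
    fix T assume "T \<in> children \<delta> (level \<S> (Suc m))"
    then obtain P x where P: "P \<in> level \<S> (Suc m)" "x \<in> \<delta> P" "T = P - {x}"
      unfolding children_def by blast
    then have "removable_pair \<S> P (\<delta> P)" using \<delta> by blast
    then have "x \<in> P" "T \<in> \<S>" using P(2,3) removable_pairD(1,3)[of \<S> P "\<delta> P"] by auto
    with P show "T \<in> level \<S> m" unfolding level_def by simp
  qed
qed

end

lemma pair_generated_above_Un_children:
  fixes \<delta> m X \<S>
  defines "\<F> \<equiv> level \<S> (Suc m)"
  assumes above: "pair_generated_above X \<S> (Suc m)" and m: "2 \<le> m"
    and \<delta>: "\<forall>S\<in>\<F>. separating_pair \<F> S (\<delta> S)"
  shows "pair_generated_above X (\<S> \<union> children \<delta> \<F>) m" (is ?above)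
    and "level (\<S> \<union> children \<delta> \<F>) m = children \<delta> \<F>" (is ?level)
proof -
  interpret pair_generated_above X \<S> "Suc m" by (rule above)
  let ?\<C> = "children \<delta> \<F>"
  have card: "card T = m" if T: "T \<in> ?\<C>" for T
  proof -
    obtain P x where P: "P \<in> \<F>" "x \<in> \<delta> P" "T = P - {x}"
      using T unfolding children_def by blast
    then have "x \<in> P" using \<delta> unfolding separating_pair_def by blast
    with P show ?thesis unfolding \<F>_def level_def by simp
  qed
  show ?level using card card_ge m unfolding level_def by fastforce
  show ?above
  proof
    show "\<S> \<union> ?\<C> \<subseteq> Pow X" using subsets unfolding children_def \<F>_def level_def by blast
    show "m \<le> card S" if "S \<in> \<S> \<union> ?\<C>" "2 \<le> card S" for S
      using that card card_ge[of S] by auto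
    show "\<exists>D. removable_pair (\<S> \<union> ?\<C>) S D" if "S \<in> \<S> \<union> ?\<C>" "m < card S" for S
      using that card \<delta> unfolding \<F>_def by (intro ex_removable_pair_Un_children) auto
  qed (use finite_X empty top singleton m in auto)
qed

lemma pair_generated_above_step_iff:
  assumes m: "2 \<le> m" "m < card X"
  shows "pair_generated_above X \<S>' m \<and> \<F>' = level \<S>' m \<longleftrightarrow>
    (\<exists>\<S>. pair_generated_above X \<S> (Suc m) \<and> next_level (level \<S> (Suc m)) \<F>' \<and> \<S>' = \<S> \<union> \<F>')"
proof
  assume current: "pair_generated_above X \<S>' m \<and> \<F>' = level \<S>' m"
  then have \<F>': "\<F>' = level \<S>' m" by blast
  interpret pair_generated_above X \<S>' m using current by blast
  let ?\<S> = "\<S>' - level \<S>' m" and ?\<F> = "level \<S>' (Suc m)"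
  have "\<forall>S\<in>?\<F>. \<exists>D. removable_pair \<S>' S D"
    using ex_removable_pair_above unfolding level_def by auto
  then obtain \<delta> where \<delta>: "\<forall>S\<in>?\<F>. removable_pair \<S>' S (\<delta> S)" by metis
  then have "\<forall>S\<in>?\<F>. separating_pair ?\<F> S (\<delta> S)"
    unfolding removable_pair_def separating_pair_def level_def by simp
  moreover have "\<F>' = children \<delta> ?\<F>" unfolding \<F>' using m(2) \<delta> by (rule level_eq_children)
  moreover have "level ?\<S> (Suc m) = ?\<F>" unfolding level_def by auto
  ultimately have "next_level (level ?\<S> (Suc m)) \<F>'" unfolding next_level_def by metis
  moreover have "pair_generated_above X ?\<S> (Suc m)"
    using m(2) by (rule pair_generated_above_Diff_level)
  moreover have "\<S>' = ?\<S> \<union> \<F>'" unfolding \<F>' level_def by auto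
  ultimately show "\<exists>\<S>. pair_generated_above X \<S> (Suc m) \<and>
      next_level (level \<S> (Suc m)) \<F>' \<and> \<S>' = \<S> \<union> \<F>'" by metis
next
  assume "\<exists>\<S>. pair_generated_above X \<S> (Suc m) \<and>
    next_level (level \<S> (Suc m)) \<F>' \<and> \<S>' = \<S> \<union> \<F>'"
  then show "pair_generated_above X \<S>' m \<and> \<F>' = level \<S>' m"
    unfolding next_level_def using pair_generated_above_Un_children[OF _ m(1)] by metis
qed

lemma next_level_iff:
  "next_level \<F> \<F>' \<longleftrightarrow>
    (\<exists>i j. (\<forall>S\<in>\<F>. i S \<in> S \<and> j S \<in> S \<and> i S \<noteq> j S \<and> (\<forall>T\<in>\<F> - {S}. \<not> {i S, j S} \<subseteq> T)) \<and>
      \<F>' = (\<Union>S\<in>\<F>. {S - {i S}, S - {j S}}))"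
    (is "_ \<longleftrightarrow> (\<exists>i j. (\<forall>S\<in>\<F>. ?chosen i j S) \<and> \<F>' = ?removed i j)")
proof
  assume "next_level \<F> \<F>'"
  then obtain \<delta> where \<delta>: "\<forall>S\<in>\<F>. separating_pair \<F> S (\<delta> S)" and \<F>': "\<F>' = children \<delta> \<F>"
    unfolding next_level_def by blast
  have "\<forall>S\<in>\<F>. \<exists>a b. \<delta> S = {a, b} \<and> a \<noteq> b"
    using \<delta> unfolding separating_pair_def card_2_iff by blast
  then obtain i j where ij: "\<forall>S\<in>\<F>. \<delta> S = {i S, j S} \<and> i S \<noteq> j S" by metis
  have "?chosen i j S" if "S \<in> \<F>" for S
  proof -
    have "separating_pair \<F> S {i S, j S}" "i S \<noteq> j S" using that \<delta> ij by metis+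
    then show ?thesis unfolding separating_pair_def by blast
  qed
  moreover have "\<F>' = ?removed i j" unfolding \<F>' children_def using ij by simp
  ultimately show "\<exists>i j. (\<forall>S\<in>\<F>. ?chosen i j S) \<and> \<F>' = ?removed i j" by blast
next
  assume "\<exists>i j. (\<forall>S\<in>\<F>. ?chosen i j S) \<and> \<F>' = ?removed i j"
  then obtain i j where "\<forall>S\<in>\<F>. ?chosen i j S" "\<F>' = ?removed i j" by blast
  then show "next_level \<F> \<F>'"
    unfolding next_level_def separating_pair_def children_def
    by (intro exI[of _ "\<lambda>S. {i S, j S}"]) auto
qed

lemma procedure_state_Suc_iff:
  "procedure_state n (Suc k) \<F>' \<S>' \<longleftrightarrow>
    (\<exists>\<S> \<F>. procedure_state n k \<F> \<S> \<and> n - k \<noteq> 2 \<and> next_level \<F> \<F>' \<and> \<S>' = \<S> \<union> \<F>')"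
  unfolding next_level_iff by (subst procedure_state.simps) auto

lemma procedure_state_iff:
  assumes "2 \<le> n"
  shows "procedure_state n k \<F> \<S> \<longleftrightarrow>
    pair_generated_above {1..n} \<S> (n - k) \<and> \<F> = level \<S> (n - k)"
proof (induction k arbitrary: \<F> \<S>)
  case 0
  have "procedure_state n 0 \<F> \<S> \<longleftrightarrow> \<S> = {{}} \<union> singletons {1..n} \<union> {{1..n}} \<and> \<F> = {{1..n}}"
    by (subst procedure_state.simps) auto
  moreover have "level ({{}} \<union> singletons {1..n} \<union> {{1..n}}) n = {{1..n}}"
    using assms unfolding level_def by auto
  moreover have "pair_generated_above {1..n} \<S> n \<longleftrightarrow> \<S> = {{}} \<union> singletons {1..n} \<union> {{1..n}}"
    using pair_generated_above_card_iff[of "{1..n}" \<S>] assms by simp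
  ultimately show ?case by auto
next
  case (Suc k)
  show ?case
  proof (cases "2 \<le> n - Suc k")
    case True
    then have m: "n - k = Suc (n - Suc k)" "n - k \<noteq> 2" "n - Suc k < card {1..n}" by auto
    show ?thesis
      unfolding procedure_state_Suc_iff pair_generated_above_step_iff[OF True m(3)] Suc.IH
      using m(1,2) by auto
  next
    case False
    then have "\<not> pair_generated_above {1..n} \<S> (n - Suc k)"
      using pair_generated_above.two_le by blast
    moreover have "\<not> (2 \<le> n - k \<and> n - k \<noteq> 2)" using False by linarith
    then have "\<not> procedure_state n (Suc k) \<F> \<S>"
      unfolding procedure_state_Suc_iff Suc.IH using pair_generated_above.two_le by blast
    ultimately show ?thesis by blast
  qed
qed

lemma procedure_output_iff:
  assumes "2 \<le> n"
  shows "procedure_output n \<S> \<longleftrightarrow> pair_generated_family {1..n} \<S>"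
proof -
  have "n - (n - 2) = 2" using assms by simp
  then show ?thesis
    unfolding procedure_output_def procedure_state_iff[OF assms] pair_generated_family_def by metis
qed

lemma labeled_atomic_lattices_iff:
  "\<S> \<in> labeled_atomic_lattices n \<longleftrightarrow> atomic_family {1..n} \<S>"
  unfolding labeled_atomic_lattices_def atomic_family_def pointed_family_def
    atomic_family_axioms_def by auto

theorem theorem4p2:
  fixes n :: nat
  assumes "n \<ge> 2"
  shows "(\<forall>\<S>. procedure_output n \<S> \<longrightarrow>
            \<S> \<in> labeled_atomic_lattices n \<and> super_atomic (inclusion_order \<S>)) \<and>
         (\<forall>\<S>. \<S> \<in> labeled_atomic_lattices n \<and> super_atomic (inclusion_order \<S>) \<longrightarrow>
            procedure_output n \<S>)"
proof -
  have "procedure_output n \<S> \<longleftrightarrow>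
      \<S> \<in> labeled_atomic_lattices n \<and> super_atomic (inclusion_order \<S>)" for \<S>
    unfolding procedure_output_iff[OF assms] pair_generated_family_iff labeled_atomic_lattices_iff
    using atomic_family.super_atomic_L_iff by blast
  then show ?thesis by blast
qed

end
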